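(* Let $G$ be a $2$-connected graph on $n\ge 3$ vertices and let $S=\{v\in V(G): d_1(v)\ge n/2\}$, where $d_1(v)$ denotes the first implicit-degree of $v$. Then $S$ is cyclable in $G$; that is, there exists a cycle $C$ in $G$ with $S\subseteq V(C)$.
   Context: All graphs are finite, simple and undirected. For a vertex $v$ of a graph $G$, $N(v)$ is its set of neighbours, $d(v)=|N(v)|$ its degree, and $N_2(v)$ the set of vertices at distance exactly $2$ from $v$ in $G$. First implicit-degree $d_1(v)$ of a vertex $v$ in a graph $G$ on $n$ vertices: If $N_2(v)\neq\emptyset$, write $d(v)=k+1$, let $M_2=\max\{d(u): u\in N_2(v)\}$, and let $d_1\le d_2\le\cdots\le d_{k+1}\le d_{k+2}\le\cdots$ be the nondecreasing sequence of the degrees (in $G$) of the vertices in $N(v)\cup N_2(v)$. Then $d_1(v)=\max\{d_{k+1},k+1\}$ if $d_{k+1}>M_2$, and $d_1(v)=\max\{d_k,k+1\}$ otherwise. If $N_2(v)=\emptyset$, then $d(v)=n-1$ (as $G$ is connected) and $d_1(v)=d(v)=n-1$. (The symbol $d_1(v)$, a function of a vertex, is not to be confused with the first term $d_1$ of the degree sequence. In a $2$-connected graph on at least $3$ vertices $d(v)\ge2$, so $k\ge1$.) *)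

theory Defs
  imports "Graph_Theory.Graph_Theory" "HOL-Library.Multiset"
begin

text \<open>Finite simple undirected graphs are the loop-free symmetric digraphs without parallel
  arcs, i.e. the locale \<^locale>\<open>graph\<close>.\<close>

definition nbrs :: "('a, 'b) pre_digraph \<Rightarrow> 'a \<Rightarrow> 'a set" where
  "nbrs G v = {u. v \<rightarrow>\<^bsub>G\<^esub> u}"

definition vdegree :: "('a, 'b) pre_digraph \<Rightarrow> 'a \<Rightarrow> nat" where
  "vdegree G v = card (nbrs G v)"

definition distance :: "('a, 'b) pre_digraph \<Rightarrow> 'a \<Rightarrow> 'a \<Rightarrow> ereal" where
  "distance G u v = wf_digraph.\<mu> G (\<lambda>_. 1) u v"

definition nbrs2 :: "('a, 'b) pre_digraph \<Rightarrow> 'a \<Rightarrow> 'a set" where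
  "nbrs2 G v = {u \<in> verts G. distance G v u = 2}"

text \<open>The sequence is numbered from 1 in the mathematics, hence the index \<open>i - 1\<close>.
  Term \<open>d k\<close> is only meaningful for \<open>k \<ge> 1\<close>, i.e. \<open>vdegree G v \<ge> 2\<close>, which holds for
  every vertex of a 2-connected graph.\<close>

definition first_implicit_degree :: "('a, 'b) pre_digraph \<Rightarrow> 'a \<Rightarrow> nat" where
  "first_implicit_degree G v =
    (if nbrs2 G v = {} then vdegree G v
     else
       let k = vdegree G v - 1;
           M2 = Max (vdegree G ` nbrs2 G v);
           ds = sorted_list_of_multiset
                  (image_mset (vdegree G) (mset_set (nbrs G v \<union> nbrs2 G v)));
           d = (\<lambda>i. ds ! (i - 1))
       in if d (k + 1) > M2 then max (d (k + 1)) (k + 1) else max (d k) (k + 1))"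

definition k_connected :: "nat \<Rightarrow> ('a, 'b) pre_digraph \<Rightarrow> bool" where
  "k_connected k G \<longleftrightarrow>
     card (verts G) > k \<and>
     (\<forall>X. X \<subseteq> verts G \<and> card X < k \<longrightarrow> Digraph_Component.connected (G \<restriction> (verts G - X)))"

text \<open>The predicate \<^const>\<open>pre_digraph.cycle\<close> also admits \<open>u, v, u\<close> traversing one edge back and
  forth, so cycles of an undirected graph are those of length at least 3. As a cycle is a closed
  walk, its vertices are the tails of its arcs.\<close>

definition cyclable :: "('a, 'b) pre_digraph \<Rightarrow> 'a set \<Rightarrow> bool" where
  "cyclable G S \<longleftrightarrow>
     (\<exists>p. pre_digraph.cycle G p \<and> length p \<ge> 3 \<and> S \<subseteq> tail G ` set p)"

end

theory Submission
  imports Defs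
begin

text \<open>
  Call a vertex heavy if its degree is at least \<open>n/2\<close>. By the closure argument of Ore, Bondy and
  Chvatal, joining two vertices of degree sum at least \<open>n\<close> creates no new cyclable sets
  (\<open>remove_edge\<close>). Hence it is enough to find a cycle through \<open>S\<close> in the graph \<open>G'\<close> obtained from
  \<open>G\<close> by making the heavy vertices a clique (\<open>cycle_of_heavy_join_cycle\<close>).

  The heavy vertices themselves lie on a cycle of \<open>G'\<close>: a clique on three or more vertices is
  traversed by a cycle, and fewer heavy vertices lie on one edge of the 2-connected graph \<open>G'\<close>,
  hence on a cycle (\<open>cycle_through_heavy\<close>). The other vertices of \<open>S\<close> are inserted one by one.

  Let \<open>v\<close> in \<open>S\<close> be light, with \<open>k + 1\<close> neighbours. Its first implicit degree is one of the two
  entries \<open>d\<^sub>k\<close> and \<open>d\<^sub>k\<^sub>+\<^sub>1\<close>, so few vertices of \<open>N(v) \<union> N\<^sub>2(v)\<close> are light. Counting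
  (\<open>first_implicit_degree_imp\<close>) shows that \<open>v\<close> has a set \<open>T\<close> of heavy neighbours which has either at
  least two elements more than the light part of \<open>N\<^sub>2(v)\<close>, or at least one element more than
  \<open>N\<^sub>2(v)\<close>. Suppose that a cycle of \<open>G'\<close> contains all heavy vertices but not \<open>v\<close>, and that \<open>v\<close>
  cannot be inserted. Then the successors on the cycle of the vertices in \<open>T\<close> are not adjacent to
  \<open>v\<close>, and are pairwise non-adjacent in \<open>G'\<close> (\<open>cycle_crossing\<close>). So at most one of them is heavy,
  and the others are light vertices of \<open>N\<^sub>2(v)\<close>. This contradicts the first alternative. In the
  second one, \<open>N\<^sub>2(v)\<close> consists exactly of the light successors, and some \<open>q\<close> in \<open>T\<close> has a heavy
  successor \<open>q'\<close>. The vertex \<open>q'\<close> is adjacent neither to \<open>v\<close> nor to \<open>N\<^sub>2(v)\<close>, and not to \<open>N(v)\<close>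
  since it lies outside \<open>N\<^sub>2(v)\<close>; but all neighbours of \<open>q\<close> lie in these three sets. So the heavy
  vertices \<open>q\<close> and \<open>q'\<close> have disjoint neighbourhoods that both avoid \<open>q'\<close>, and their degrees sum
  to less than \<open>n\<close>, which is absurd (\<open>insert_vertex\<close>).
\<close>

section \<open>Cycles as vertex lists\<close>

definition is_cycle :: "('a \<Rightarrow> 'a \<Rightarrow> bool) \<Rightarrow> 'a list \<Rightarrow> bool" where
  "is_cycle E xs \<longleftrightarrow>
     3 \<le> length xs \<and> distinct xs \<and> successively E xs \<and> E (last xs) (hd xs)"

definition next_in :: "'a list \<Rightarrow> 'a \<Rightarrow> 'a" where
  "next_in xs p = hd (tl (dropWhile (\<lambda>x. x \<noteq> p) xs) @ xs)"

lemma is_cycle_rotate: "is_cycle E (xs @ ys) \<Longrightarrow> is_cycle E (ys @ xs)"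
  by (cases "xs = []"; cases "ys = []") (auto simp: is_cycle_def successively_append_iff)

lemma is_cycle_not_Nil: "is_cycle E xs \<Longrightarrow> xs \<noteq> []"
  by (auto simp: is_cycle_def)

lemma successively_rev_symp:
  assumes "symp E"
  shows "successively E (rev xs) = successively E xs"
proof -
  have "(\<lambda>x y. E y x) = E" using assms by (auto simp: fun_eq_iff symp_def)
  then show ?thesis
    unfolding successively_rev by (rule arg_cong[of _ _ "\<lambda>R. successively R xs"])
qed

lemma is_cycle_snoc:
  assumes "is_cycle E xs" "v \<notin> set xs" "E (last xs) v" "E v (hd xs)"
  shows "is_cycle E (xs @ [v])"
  using assms is_cycle_not_Nil[OF assms(1)]
  by (auto simp: is_cycle_def successively_append_iff)

lemma next_in_decomp:
  assumes "p \<notin> set as"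
  shows "next_in (as @ p # bs) p = hd (bs @ as @ [p])"
proof -
  have "dropWhile (\<lambda>x. x \<noteq> p) (as @ p # bs) = p # bs"
    using assms by (induction as) auto
  then show ?thesis by (cases bs; cases as) (auto simp: next_in_def)
qed

text \<open>
  A cycle may be read off from any of its vertices; choosing the list that ends in \<open>p\<close> turns
  statements about the successor of \<open>p\<close> into statements about the head of a list.
\<close>
lemma cycle_cut:
  assumes "is_cycle E xs" "p \<in> set xs"
  obtains zs where "is_cycle E zs" "set zs = set xs" "last zs = p" "hd zs = next_in xs p"
proof -
  obtain as bs where xs: "xs = as @ p # bs"
    using assms(2) by (auto simp: in_set_conv_decomp)
  have "is_cycle E (bs @ as @ [p])"
    using is_cycle_rotate[of E "as @ [p]" bs] assms(1) xs by simp
  moreover have "next_in xs p = hd (bs @ as @ [p])"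
    using assms(1) unfolding xs by (intro next_in_decomp) (auto simp: is_cycle_def)
  ultimately show ?thesis using that[of "bs @ as @ [p]"] xs by auto
qed

lemma next_in_edge:
  assumes "is_cycle E xs" "p \<in> set xs"
  shows "E p (next_in xs p)" "next_in xs p \<in> set xs"
proof -
  obtain zs where "is_cycle E zs" "set zs = set xs" "last zs = p" "hd zs = next_in xs p"
    using cycle_cut assms by metis
  then show "E p (next_in xs p)" "next_in xs p \<in> set xs"
    using is_cycle_not_Nil[of E zs] hd_in_set[of zs] by (auto simp: is_cycle_def)
qed

lemma cycle_cut_twice:
  assumes "is_cycle E xs" "p \<in> set xs" "q \<in> set xs" "p \<noteq> q"
  obtains ys zs where "is_cycle E (ys @ zs)" "set (ys @ zs) = set xs" "ys \<noteq> []" "zs \<noteq> []"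
    "last ys = p" "hd zs = next_in xs p" "last zs = q" "hd ys = next_in xs q"
proof -
  have cut: "\<exists>ys zs. is_cycle E (ys @ zs) \<and> set (ys @ zs) = set xs \<and> ys \<noteq> [] \<and> zs \<noteq> [] \<and>
      last ys = p \<and> hd zs = next_in xs p \<and> last zs = q \<and> hd ys = next_in xs q"
    if xs: "xs = as @ p # bs @ q # cs" for p q as bs cs
  proof (intro exI conjI)
    have dist: "distinct xs" using assms(1) by (simp add: is_cycle_def)
    show "is_cycle E ((cs @ as @ [p]) @ (bs @ [q]))"
      using is_cycle_rotate[of E "as @ p # bs @ [q]" cs] assms(1) xs by simp
    show "hd (bs @ [q]) = next_in xs p"
      using next_in_decomp[of p as "bs @ q # cs"] dist xs by (cases bs) auto
    show "hd (cs @ as @ [p]) = next_in xs q"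
      using next_in_decomp[of q "as @ p # bs" cs] dist xs by (cases cs; cases as) auto
  qed (use xs in auto)
  obtain as bs where xs: "xs = as @ p # bs"
    using assms(2) by (auto simp: in_set_conv_decomp)
  then consider "q \<in> set bs" | "q \<in> set as" using assms(3,4) by auto
  then show ?thesis
  proof cases
    case 1
    then obtain cs ds where "bs = cs @ q # ds" by (auto simp: in_set_conv_decomp)
    with cut xs that show ?thesis by blast
  next
    case 2
    then obtain cs ds where "as = cs @ q # ds" by (auto simp: in_set_conv_decomp)
    with xs have "xs = cs @ q # ds @ p # bs" by simp
    from cut[OF this] obtain ys zs where
      "is_cycle E (ys @ zs)" "set (ys @ zs) = set xs" "ys \<noteq> []" "zs \<noteq> []"
      "last ys = q" "hd zs = next_in xs q" "last zs = p" "hd ys = next_in xs p" by blast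
    then show ?thesis using that[of zs ys] is_cycle_rotate[of E ys zs] by auto
  qed
qed

lemma inj_on_next_in:
  assumes "is_cycle E xs"
  shows "inj_on (next_in xs) (set xs)"
proof (rule inj_onI, rule ccontr)
  fix p q assume pq: "p \<in> set xs" "q \<in> set xs" "next_in xs p = next_in xs q" "p \<noteq> q"
  obtain ys zs where *: "is_cycle E (ys @ zs)" "ys \<noteq> []" "zs \<noteq> []"
    "hd zs = next_in xs p" "hd ys = next_in xs q"
    using cycle_cut_twice[OF assms pq(1,2,4)] by metis
  then have "hd zs \<in> set zs \<inter> set ys" using pq(3) hd_in_set by (metis IntI)
  with * show False by (auto simp: is_cycle_def)
qed

text \<open>
  With \<open>ys\<close> running from the successor of \<open>q\<close> to \<open>p\<close>, and \<open>zs\<close> from the successor of \<open>p\<close> to \<open>q\<close>,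
  the new cycle runs from \<open>v\<close> to \<open>p\<close>, backwards through \<open>ys\<close>, crosses between the two successors,
  and returns through \<open>zs\<close> and \<open>q\<close> to \<open>v\<close>.
\<close>
lemma cycle_crossing:
  assumes "is_cycle E xs" "symp E" "p \<in> set xs" "q \<in> set xs" "p \<noteq> q"
    "v \<notin> set xs" "E v p" "E v q" "E (next_in xs p) (next_in xs q)"
  obtains zs where "is_cycle E zs" "set zs = insert v (set xs)"
proof -
  obtain ys zs where *: "is_cycle E (ys @ zs)" "set (ys @ zs) = set xs" "ys \<noteq> []" "zs \<noteq> []"
    "last ys = p" "hd zs = next_in xs p" "last zs = q" "hd ys = next_in xs q"
    using cycle_cut_twice[OF assms(1,3,4,5)] by metis
  have "is_cycle E (v # rev ys @ zs)"
    using * assms sympD[OF assms(2)]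
    by (auto simp: is_cycle_def successively_append_iff successively_Cons
          successively_rev_symp[OF assms(2)] hd_rev last_rev hd_append
          simp del: successively_rev)
  moreover have "set (v # rev ys @ zs) = insert v (set xs)" using *(2) by auto
  ultimately show ?thesis using that by blast
qed

section \<open>Joining the heavy vertices\<close>

locale sgraph =
  fixes V :: "'a set" and E :: "'a \<Rightarrow> 'a \<Rightarrow> bool"
  assumes finite_V: "finite V"
    and adj_in_V: "E x y \<Longrightarrow> x \<in> V"
    and sym: "symp E"
    and irrefl: "\<not> E x x"
begin

definition N :: "'a \<Rightarrow> 'a set" where "N x = {y. E x y}"

definition N2 :: "'a \<Rightarrow> 'a set" where
  "N2 x = {y. y \<noteq> x \<and> \<not> E x y \<and> (\<exists>z. E x z \<and> E z y)}"

lemma adj_sym: "E x y \<Longrightarrow> E y x"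
  using sym by (rule sympD)

lemma N_subset: "N x \<subseteq> V"
  using adj_in_V adj_sym by (auto simp: N_def)

lemma finite_N: "finite (N x)"
  using N_subset finite_V by (rule finite_subset)

lemma N2_subset: "N2 x \<subseteq> V"
  using adj_in_V adj_sym by (auto simp: N2_def)

lemma finite_N2: "finite (N2 x)"
  using N2_subset finite_V by (rule finite_subset)

text \<open>
  Ore's argument. If the two ends of the path have no common neighbour outside it, then their
  neighbourhoods outside the path are disjoint, so on the path their degrees sum to at least its
  number of vertices. By pigeonhole, some edge of the path then has its first vertex adjacent to the
  last vertex of the path, and its second vertex adjacent to the first; exchanging that edge for the
  two chords closes the path to a cycle.
\<close>
lemma close_path:
  assumes path: "distinct xs" "3 \<le> length xs" "successively E xs" "set xs \<subseteq> V"
    and degree_sum: "card V \<le> card (N (hd xs)) + card (N (last xs))"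
  obtains ys where "is_cycle E ys" "set xs \<subseteq> set ys"
proof (cases "\<exists>w. w \<notin> set xs \<and> E (hd xs) w \<and> E (last xs) w")
  case True
  then obtain w where w: "w \<notin> set xs" "E (hd xs) w" "E (last xs) w" by blast
  then have "is_cycle E (xs @ [w])"
    using path adj_sym by (auto simp: is_cycle_def successively_append_iff hd_append)
  then show ?thesis using that[of "xs @ [w]"] by auto
next
  case False
  define u v m where "u = hd xs" and "v = last xs" and "m = length xs"
  have ne: "xs \<noteq> []" using path(2) by auto
  have u: "u = xs ! 0" and v: "v = xs ! (m - 1)"
    using ne by (auto simp: u_def v_def m_def hd_conv_nth last_conv_nth)
  define X Y where "X = {i. Suc i < m \<and> E u (xs ! Suc i)}" and "Y = {i. Suc i < m \<and> E v (xs ! i)}"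
  show ?thesis
  proof (cases "X \<inter> Y = {}")
    case False
    then obtain i where i: "Suc i < m" "E u (xs ! Suc i)" "E v (xs ! i)"
      by (auto simp: X_def Y_def)
    define as bs where "as = take (Suc i) xs" and "bs = drop (Suc i) xs"
    have xs: "xs = as @ bs" by (simp add: as_def bs_def)
    have ab: "as \<noteq> []" "bs \<noteq> []" using i(1) ne by (auto simp: as_def bs_def m_def)
    have "last as = xs ! i" "hd bs = xs ! Suc i"
      using i(1) by (auto simp: as_def bs_def m_def take_Suc_conv_app_nth hd_drop_conv_nth)
    moreover have "hd as = u" "last bs = v" using ab by (auto simp: u_def v_def xs)
    ultimately have "is_cycle E (as @ rev bs)"
      using path(1-3) ab i(2,3) adj_sym unfolding xs
      by (auto simp: is_cycle_def successively_append_iff successively_rev_symp[OF sym]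
          hd_rev last_rev simp del: successively_rev)
    then show ?thesis using that[of "as @ rev bs"] xs by auto
  next
    case disj: True
    have fin_XY: "finite X" "finite Y"
      by (rule finite_subset[of _ "{..<m}"]; force simp: X_def Y_def)+
    have "card X + card Y = card (X \<union> Y)"
      using disj fin_XY by (intro card_Un_disjoint[symmetric]) auto
    also have "\<dots> \<le> card {..<m - 1}"
      by (intro card_mono) (auto simp: X_def Y_def)
    finally have XY: "card X + card Y \<le> m - 1" by simp
    have "N u \<inter> set xs \<subseteq> (\<lambda>i. xs ! Suc i) ` X"
    proof
      fix w assume w: "w \<in> N u \<inter> set xs"
      then obtain j where j: "j < m" "w = xs ! j" by (auto simp: in_set_conv_nth m_def)
      then have "j \<noteq> 0" using w irrefl u by (intro notI) (simp add: N_def)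
      then show "w \<in> (\<lambda>i. xs ! Suc i) ` X"
        using j w by (auto simp: X_def N_def image_iff intro!: exI[of _ "j - 1"])
    qed
    then have "card (N u \<inter> set xs) \<le> card X"
      by (rule surj_card_le[OF fin_XY(1)])
    moreover have "N v \<inter> set xs \<subseteq> (\<lambda>i. xs ! i) ` Y"
    proof
      fix w assume w: "w \<in> N v \<inter> set xs"
      then obtain j where j: "j < m" "w = xs ! j" by (auto simp: in_set_conv_nth m_def)
      then have "j \<noteq> m - 1" using w irrefl v by (intro notI) (simp add: N_def)
      then show "w \<in> (\<lambda>i. xs ! i) ` Y"
        using j w by (auto simp: Y_def N_def image_iff intro!: exI[of _ j])
    qed
    then have "card (N v \<inter> set xs) \<le> card Y"
      by (rule surj_card_le[OF fin_XY(2)])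
    moreover have "card (N u - set xs) + card (N v - set xs) \<le> card (V - set xs)"
    proof -
      have "card (N u - set xs) + card (N v - set xs) = card ((N u - set xs) \<union> (N v - set xs))"
        using False finite_N by (intro card_Un_disjoint[symmetric]) (auto simp: N_def u_def v_def)
      also have "\<dots> \<le> card (V - set xs)"
        using N_subset finite_V by (intro card_mono) auto
      finally show ?thesis .
    qed
    moreover have "card (N u) = card (N u \<inter> set xs) + card (N u - set xs)"
      "card (N v) = card (N v \<inter> set xs) + card (N v - set xs)"
      "card V = m + card (V - set xs)"
      using card_Int_Diff[OF finite_N] card_Int_Diff[OF finite_V, of "set xs"] path(1,4)
      by (auto simp: m_def distinct_card Int_absorb1)
    moreover have "0 < m" using ne by (simp add: m_def)
    ultimately show ?thesis using degree_sum XY by (simp add: u_def v_def)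
  qed
qed

text \<open>
  A cycle that uses the added edge \<open>uv\<close> is a path of the original graph between \<open>u\<close> and \<open>v\<close>, so
  that \<open>close_path\<close> applies to it.
\<close>
lemma remove_edge:
  assumes cyc: "is_cycle (\<lambda>x y. E x y \<or> x \<noteq> y \<and> {x, y} = {u, v}) xs" and "set xs \<subseteq> V"
    and degree_sum: "card V \<le> card (N u) + card (N v)"
  obtains ys where "is_cycle E ys" "set xs \<subseteq> set ys"
proof (cases "is_cycle E xs")
  case True
  then show ?thesis using that by blast
next
  case False
  let ?E' = "\<lambda>x y. E x y \<or> x \<noteq> y \<and> {x, y} = {u, v}"
  have "\<exists>zs. is_cycle ?E' zs \<and> set zs = set xs \<and> {last zs, hd zs} = {u, v}"
  proof (cases "E (last xs) (hd xs)")
    case False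
    with cyc show ?thesis by (auto simp: is_cycle_def)
  next
    case True
    then have "\<not> successively E xs" using False cyc by (auto simp: is_cycle_def)
    then obtain i where i: "Suc i < length xs" "\<not> E (xs ! i) (xs ! Suc i)"
      by (auto simp: successively_conv_nth)
    moreover have "successively ?E' xs" using cyc by (simp add: is_cycle_def)
    ultimately have e: "{xs ! i, xs ! Suc i} = {u, v}"
      by (auto simp: successively_conv_nth)
    have "is_cycle ?E' (drop (Suc i) xs @ take (Suc i) xs)"
      by (rule is_cycle_rotate) (simp add: cyc)
    moreover have "set (drop (Suc i) xs @ take (Suc i) xs) = set xs"
      by (metis Un_commute append_take_drop_id set_append)
    moreover have "last (drop (Suc i) xs @ take (Suc i) xs) = xs ! i"
      "hd (drop (Suc i) xs @ take (Suc i) xs) = xs ! Suc i"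
      using i by (auto simp: last_append last_conv_nth hd_drop_conv_nth hd_append min_def)
    ultimately show ?thesis
      using e by (intro exI[of _ "drop (Suc i) xs @ take (Suc i) xs"]) simp
  qed
  then obtain zs where zs: "is_cycle ?E' zs" "set zs = set xs" "{last zs, hd zs} = {u, v}"
    by blast
  have path: "distinct zs" "3 \<le> length zs" "successively ?E' zs"
    using zs(1) by (auto simp: is_cycle_def)
  have "successively E zs"
    unfolding successively_conv_nth
  proof (intro allI impI)
    fix i assume i: "Suc i < length zs"
    have "{zs ! i, zs ! Suc i} \<noteq> {u, v}"
    proof
      assume "{zs ! i, zs ! Suc i} = {u, v}"
      then have "{zs ! i, zs ! Suc i} = {zs ! (length zs - 1), zs ! 0}"
        using zs(3) is_cycle_not_Nil[OF zs(1)] by (simp add: hd_conv_nth last_conv_nth)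
      then consider "zs ! Suc i = zs ! 0" | "zs ! i = zs ! 0" "zs ! Suc i = zs ! (length zs - 1)"
        unfolding doubleton_eq_iff by blast
      then show False
      proof cases
        case 1
        then show False using i path(1) nth_eq_iff_index_eq[of zs "Suc i" 0] by fastforce
      next
        case 2
        then have "i = 0" "Suc i = length zs - 1"
          using i path(1) is_cycle_not_Nil[OF zs(1)] nth_eq_iff_index_eq[of zs i 0]
            nth_eq_iff_index_eq[of zs "Suc i" "length zs - 1"] by auto
        then show False using path(2) by simp
      qed
    qed
    then show "E (zs ! i) (zs ! Suc i)" using path(3) i by (auto simp: successively_conv_nth)
  qed
  moreover have "card V \<le> card (N (hd zs)) + card (N (last zs))"
    using degree_sum zs(3) by (auto simp: doubleton_eq_iff)
  ultimately show ?thesis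
    using close_path[of zs] path zs(2) assms(2) that by metis
qed

definition heavy :: "'a set" where
  "heavy = {x \<in> V. card V \<le> 2 * card (N x)}"

definition heavy_join :: "'a \<Rightarrow> 'a \<Rightarrow> bool" where
  "heavy_join x y \<longleftrightarrow> E x y \<or> x \<in> heavy \<and> y \<in> heavy \<and> x \<noteq> y"

lemma sgraph_heavy_join: "sgraph V heavy_join"
  using finite_V adj_in_V adj_sym irrefl
  by unfold_locales (auto simp: heavy_join_def heavy_def symp_def)

text \<open>
  The added edges are removed one at a time. Edges present at an intermediate stage only raise the
  degrees, so the degree sum condition holds throughout.
\<close>
lemma cycle_of_heavy_join_cycle:
  assumes "is_cycle heavy_join xs"
  obtains ys where "is_cycle E ys" "set xs \<subseteq> set ys"
proof -
  interpret K: sgraph V heavy_join by (rule sgraph_heavy_join)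
  \<comment> \<open>\<open>F\<close> is a set of undirected edges; the condition \<open>x \<noteq> y\<close> excludes the singletons it may contain.\<close>
  define E' where "E' F x y \<longleftrightarrow> E x y \<or> x \<noteq> y \<and> {x, y} \<in> F" for F x y
  have remove: "\<exists>ys. is_cycle E ys \<and> set xs \<subseteq> set ys"
    if "finite F" "F \<subseteq> {{x, y} |x y. x \<in> heavy \<and> y \<in> heavy}" "is_cycle (E' F) xs" for F xs
    using that
  proof (induction F arbitrary: xs rule: finite_induct)
    case empty
    then show ?case by (auto simp: E'_def)
  next
    case (insert e F)
    then obtain u v where e: "e = {u, v}" and uv: "u \<in> heavy" "v \<in> heavy" by auto
    have F_V: "x \<in> V" if "{x, y} \<in> insert e F" for x y
    proof -
      have "{x, y} \<in> {{x, y} |x y. x \<in> heavy \<and> y \<in> heavy}"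
        using that insert.prems(1) by (rule subsetD[rotated])
      then have "x \<in> heavy" by (auto simp: doubleton_eq_iff)
      then show ?thesis by (simp add: heavy_def)
    qed
    interpret F: sgraph V "E' F"
    proof
      show "x \<in> V" if "E' F x y" for x y
        using that adj_in_V F_V[of x y] by (auto simp: E'_def)
    qed (use finite_V adj_sym irrefl in \<open>auto simp: E'_def symp_def insert_commute\<close>)
    have "N x \<subseteq> F.N x" for x by (auto simp: N_def F.N_def E'_def)
    then have "card (N x) \<le> card (F.N x)" for x using F.finite_N by (intro card_mono)
    then have degree_sum: "card V \<le> card (F.N u) + card (F.N v)"
      using uv add_mono[of "card (N u)" "card (F.N u)" "card (N v)" "card (F.N v)"]
      by (simp add: heavy_def)
    have cyc: "is_cycle (\<lambda>x y. E' F x y \<or> x \<noteq> y \<and> {x, y} = {u, v}) xs"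
    proof -
      have "E' (Set.insert e F) = (\<lambda>x y. E' F x y \<or> x \<noteq> y \<and> {x, y} = {u, v})"
        by (auto simp: fun_eq_iff E'_def e)
      then show ?thesis using insert.prems(2) by simp
    qed
    have "set xs \<subseteq> V"
    proof
      fix x assume "x \<in> set xs"
      then have "E' (Set.insert e F) x (next_in xs x)"
        by (rule next_in_edge(1)[OF insert.prems(2)])
      then show "x \<in> V" using adj_in_V F_V[of x "next_in xs x"] by (auto simp: E'_def)
    qed
    then obtain ys where "is_cycle (E' F) ys" "set xs \<subseteq> set ys"
      using F.remove_edge[OF cyc _ degree_sum] by blast
    then show ?case using insert.IH[of ys] insert.prems(1) by auto
  qed
  let ?F = "{{x, y} |x y. x \<in> heavy \<and> y \<in> heavy}"
  have "heavy_join = E' ?F"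
    by (auto simp: fun_eq_iff heavy_join_def E'_def doubleton_eq_iff)
  then have "is_cycle (E' ?F) xs" using assms by simp
  moreover have "finite ?F"
    by (rule finite_subset[of _ "Pow V"]) (use finite_V in \<open>auto simp: heavy_def\<close>)
  ultimately show ?thesis using remove[OF _ order_refl] that by blast
qed

section \<open>Inserting a light vertex\<close>

text \<open>
  If \<open>v\<close> cannot be inserted, then \<open>v\<close> together with the successors of its heavy neighbours is an
  independent set of the enlarged graph. All but one of these successors are light members of
  \<open>N2 v\<close>, which exhausts \<open>N2 v\<close>; the exceptional one and its predecessor are heavy vertices with
  disjoint neighbourhoods, too small to have degree sum \<open>card V\<close>.
\<close>
lemma insert_vertex:
  assumes cyc: "is_cycle heavy_join xs" "heavy \<subseteq> set xs"
    and v: "v \<notin> set xs"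
    and card: "card (N2 v - heavy) + 2 \<le> card (N v \<inter> heavy) \<or>
      card (N2 v) + 1 \<le> card (N v \<inter> heavy)"
  obtains ys where "is_cycle heavy_join ys" "set ys = insert v (set xs)"
proof (rule ccontr)
  note extension = that
  assume no_cycle: "\<not> thesis"
  interpret K: sgraph V heavy_join by (rule sgraph_heavy_join)
  define T where "T = N v \<inter> heavy"
  define f where "f = next_in xs"
  have T_xs: "T \<subseteq> set xs" using cyc(2) by (auto simp: T_def)
  have finT: "finite T" using finite_N by (simp add: T_def)
  have inj: "inj_on f T"
    unfolding f_def using inj_on_subset[OF inj_on_next_in[OF cyc(1)] T_xs] .
  have step: "heavy_join t (f t)" "f t \<in> set xs" if "t \<in> T" for t
    using next_in_edge[OF cyc(1)] that T_xs by (auto simp: f_def)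
  have vT: "heavy_join v t" if "t \<in> T" for t
    using that by (auto simp: T_def N_def heavy_join_def)
  have not_adj_v: "\<not> heavy_join v (f t)" if t: "t \<in> T" for t
  proof
    assume a: "heavy_join v (f t)"
    obtain zs where "is_cycle heavy_join zs" "set zs = set xs" "last zs = t" "hd zs = f t"
      using cycle_cut[OF cyc(1), of t] t T_xs unfolding f_def by blast
    then have "is_cycle heavy_join (zs @ [v])" "set (zs @ [v]) = insert v (set xs)"
      using is_cycle_snoc[of heavy_join zs v] a v vT[OF t] K.adj_sym by auto
    then show False using no_cycle extension by blast
  qed
  have indep: "\<not> heavy_join (f s) (f t)" if "s \<in> T" "t \<in> T" for s t
  proof (cases "s = t")
    case True
    then show ?thesis using K.irrefl by simp
  next
    case False
    then show ?thesis
      using cycle_crossing[OF cyc(1) K.sym, of s t v] that T_xs v vT no_cycle extension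
      unfolding f_def by (metis subsetD)
  qed
  \<comment> \<open>An edge to a light vertex is an edge of the original graph.\<close>
  have light: "f t \<in> N2 v" if "t \<in> T" "f t \<notin> heavy" for t
  proof -
    have "E t (f t)" using step(1)[OF that(1)] that(2) by (simp add: heavy_join_def)
    moreover have "f t \<noteq> v" using step(2)[OF that(1)] v by auto
    ultimately show ?thesis
      using not_adj_v[OF that(1)] that(1) by (auto simp: N2_def N_def T_def heavy_join_def)
  qed
  have "card (f ` T \<inter> heavy) \<le> 1"
    using indep finT by (auto simp: card_le_Suc0_iff_eq heavy_join_def)
  moreover have "card T = card (f ` T \<inter> heavy) + card (f ` T - heavy)"
    using card_Int_Diff[of "f ` T" heavy] finT card_image[OF inj] by simp
  moreover have "card (f ` T - heavy) \<le> card (N2 v - heavy)"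
    using light finite_N2 by (intro card_mono) auto
  moreover have "card (N2 v - heavy) \<le> card (N2 v)"
    using finite_N2 by (intro card_mono) auto
  ultimately have eq: "card (f ` T - heavy) = card (N2 v)" "card (f ` T \<inter> heavy) = 1"
    using card by (auto simp: T_def)
  have N2: "N2 v = f ` T - heavy"
    using light finite_N2 eq(1) by (intro card_subset_eq[symmetric]) auto
  have "f ` T \<inter> heavy \<noteq> {}" using eq(2) by auto
  then obtain q where q: "q \<in> T" "f q \<in> heavy" by blast
  \<comment> \<open>Every neighbour of \<open>q\<close> is \<open>v\<close>, a neighbour of \<open>v\<close>, or in \<open>N2 v\<close>, as \<open>q\<close> is adjacent to \<open>v\<close>.\<close>
  have "N q \<inter> N (f q) = {}"
  proof -
    have "w \<notin> N (f q)" if w: "w \<in> N q" for w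
    proof -
      have "E v q" using q(1) by (simp add: T_def N_def)
      then consider "w = v" | "E v w" | "w \<in> N2 v"
        using w by (auto simp: N_def N2_def)
      then show ?thesis
      proof cases
        case 1
        then show ?thesis using not_adj_v[OF q(1)] adj_sym by (auto simp: N_def heavy_join_def)
      next
        case 2
        show ?thesis
        proof
          assume w: "w \<in> N (f q)"
          have "f q \<noteq> v" using step(2)[OF q(1)] v by auto
          then have "f q \<in> N2 v"
            using 2 w not_adj_v[OF q(1)] adj_sym by (auto simp: N_def N2_def heavy_join_def)
          then show False using N2 q(2) by blast
        qed
      next
        case 3
        then show ?thesis using N2 indep[OF q(1)] by (auto simp: N_def heavy_join_def)
      qed
    qed
    then show ?thesis by blast
  qed
  moreover have "f q \<notin> N q"
  proof
    assume "f q \<in> N q"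
    moreover have "f q \<noteq> v" using step(2)[OF q(1)] v by auto
    ultimately have "f q \<in> N2 v"
      using q(1) not_adj_v[OF q(1)] by (auto simp: N_def N2_def T_def heavy_join_def)
    then show False using N2 q(2) by blast
  qed
  ultimately have "card (N q) + card (N (f q)) \<le> card (V - {f q})"
    using N_subset finite_V finite_N irrefl
    by (subst card_Un_disjoint[symmetric]) (auto intro!: card_mono simp: N_def)
  moreover have "card (V - {f q}) < card V"
    using q(2) finite_V by (intro psubset_card_mono) (auto simp: heavy_def)
  ultimately show False using q by (auto simp: T_def heavy_def)
qed

end

section \<open>2-connected graphs\<close>

lemma path_of_rtranclp:
  assumes "R\<^sup>*\<^sup>* x y"
  shows "\<exists>xs. xs \<noteq> [] \<and> distinct xs \<and> successively R xs \<and> hd xs = x \<and> last xs = y"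
  using assms
proof (induction rule: rtranclp_induct)
  case base
  show ?case by (intro exI[of _ "[x]"]) auto
next
  case (step y z)
  then obtain xs where xs: "xs \<noteq> []" "distinct xs" "successively R xs" "hd xs = x" "last xs = y"
    by blast
  show ?case
  proof (cases "z \<in> set xs")
    case True
    then obtain as bs where "xs = (as @ [z]) @ bs" by (auto simp: in_set_conv_decomp)
    then show ?thesis using xs
      by (intro exI[of _ "as @ [z]"]) (auto simp: successively_append_iff hd_append split: if_splits)
  next
    case False
    then show ?thesis using xs step(2)
      by (intro exI[of _ "xs @ [z]"]) (auto simp: successively_append_iff)
  qed
qed

locale biconnected_sgraph = sgraph +
  assumes three_vertices: "3 \<le> card V"
    and connected_minus: "\<lbrakk>w \<in> V; x \<in> V - {w}; y \<in> V - {w}\<rbrakk> \<Longrightarrow>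
      (\<lambda>a b. E a b \<and> a \<noteq> w \<and> b \<noteq> w)\<^sup>*\<^sup>* x y"
begin

lemma neighbour_avoiding:
  assumes "w \<in> V" "v \<in> V" "v \<noteq> w"
  obtains c where "E v c" "c \<noteq> w"
proof -
  have "\<not> V \<subseteq> {v, w}"
    using three_vertices card_mono[of "{v, w}" V] card_insert_le_m1[of 2 "{w}" v] by force
  then obtain z where z: "z \<in> V" "z \<noteq> v" "z \<noteq> w" by blast
  then have "(\<lambda>a b. E a b \<and> a \<noteq> w \<and> b \<noteq> w)\<^sup>*\<^sup>* v z"
    using assms by (intro connected_minus) auto
  then show ?thesis
    using z(2) that by (auto elim: converse_rtranclpE)
qed

lemma two_neighbours:
  assumes "v \<in> V"
  obtains b c where "E v b" "E v c" "b \<noteq> c"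
proof -
  have "\<not> V \<subseteq> {v}"
    using three_vertices card_mono[of "{v}" V] by force
  then obtain w where "w \<in> V" "w \<noteq> v" by blast
  then obtain b where b: "E v b" using neighbour_avoiding[of w v] assms by blast
  then obtain c where "E v c" "c \<noteq> b"
    using neighbour_avoiding[of b v] assms adj_in_V adj_sym irrefl by metis
  with b that show ?thesis by blast
qed

lemma degree_ge_2:
  assumes "v \<in> V"
  shows "2 \<le> card (N v)"
proof -
  obtain b c where "E v b" "E v c" "b \<noteq> c" using two_neighbours[OF assms] .
  then have "card {b, c} \<le> card (N v)" using finite_N by (intro card_mono) (auto simp: N_def)
  with \<open>b \<noteq> c\<close> show ?thesis by simp
qed

text \<open>
  Deleting \<open>a\<close> leaves \<open>b\<close> connected to a second neighbour of \<open>a\<close>; the connecting path and \<open>a\<close> form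
  the cycle.
\<close>
lemma edge_on_cycle:
  assumes "E a b"
  obtains xs where "is_cycle E xs" "a \<in> set xs" "b \<in> set xs"
proof -
  have ab: "a \<in> V" "b \<in> V" "a \<noteq> b" using assms adj_in_V adj_sym irrefl by blast+
  then obtain c where c: "E a c" "c \<noteq> b" using neighbour_avoiding[of b a] by blast
  then have "c \<in> V - {a}" using adj_in_V adj_sym irrefl by blast
  then obtain xs where xs: "xs \<noteq> []" "distinct xs"
      "successively (\<lambda>x y. E x y \<and> x \<noteq> a \<and> y \<noteq> a) xs" "hd xs = b" "last xs = c"
    using path_of_rtranclp[OF connected_minus[of a b c]] ab by blast
  have "a \<notin> set xs"
  proof
    assume "a \<in> set xs"
    then obtain as bs where "xs = as @ a # bs" by (auto simp: in_set_conv_decomp)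
    then show False using xs ab c
      by (cases bs; cases as rule: rev_cases) (auto simp: successively_append_iff successively_Cons)
  qed
  moreover have "successively E xs" using xs(3) by (rule successively_mono) auto
  moreover have "2 \<le> length xs" using xs(1,4,5) c(2) by (cases xs; cases "tl xs") auto
  ultimately have "is_cycle E (a # xs)"
    using xs assms c adj_sym by (auto simp: is_cycle_def successively_Cons)
  then show ?thesis using that[of "a # xs"] xs(1,4) by auto
qed

lemma biconnected_heavy_join: "biconnected_sgraph V heavy_join"
proof -
  interpret K: sgraph V heavy_join by (rule sgraph_heavy_join)
  show ?thesis
  proof
    fix w x y assume "w \<in> V" "x \<in> V - {w}" "y \<in> V - {w}"
    from connected_minus[OF this]
    show "(\<lambda>a b. heavy_join a b \<and> a \<noteq> w \<and> b \<noteq> w)\<^sup>*\<^sup>* x y"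
      by (rule rtranclp_mono[THEN predicate2D, rotated]) (auto simp: heavy_join_def)
  qed (rule three_vertices)
qed

lemma cycle_through_heavy:
  obtains xs where "is_cycle heavy_join xs" "heavy \<subseteq> set xs"
proof (cases "3 \<le> card heavy")
  case True
  have "finite heavy" using finite_V by (simp add: heavy_def)
  then obtain xs where xs: "set xs = heavy" "distinct xs" using finite_distinct_list by blast
  have "length xs = card heavy" using xs distinct_card by metis
  with True have len: "3 \<le> length xs" by simp
  have clique: "heavy_join (xs ! i) (xs ! j)" if "i < length xs" "j < length xs" "i \<noteq> j" for i j
    using that xs nth_mem by (fastforce simp: heavy_join_def nth_eq_iff_index_eq)
  then have "is_cycle heavy_join xs"
    using xs(2) len clique[of "length xs - 1" 0]
    by (auto simp: is_cycle_def successively_conv_nth hd_conv_nth last_conv_nth intro!: clique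
        simp flip: length_greater_0_conv)
  then show ?thesis using that xs(1) by auto
next
  case False
  interpret K: biconnected_sgraph V heavy_join by (rule biconnected_heavy_join)
  have fin: "finite heavy" using finite_V by (simp add: heavy_def)
  have "\<exists>a b. heavy_join a b \<and> heavy \<subseteq> {a, b}"
  proof -
    consider "card heavy = 0" | "card heavy = 1" | "card heavy = 2" using False by linarith
    then show ?thesis
    proof cases
      case 1
      then have "heavy = {}" using fin by simp
      moreover obtain v where v: "v \<in> V" using three_vertices by fastforce
      obtain b c where "heavy_join v b" "heavy_join v c" "b \<noteq> c" using K.two_neighbours[OF v] .
      ultimately show ?thesis by blast
    next
      case 2
      then obtain a where a: "heavy = {a}" by (auto simp: card_1_singleton_iff)
      then have "a \<in> V" by (auto simp: heavy_def)
      then obtain b c where "heavy_join a b" "heavy_join a c" "b \<noteq> c" using K.two_neighbours[of a]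
        by blast
      then show ?thesis using a by blast
    next
      case 3
      then obtain a b where "heavy = {a, b}" "a \<noteq> b" by (auto simp: card_2_iff)
      then show ?thesis by (intro exI[of _ a] exI[of _ b]) (auto simp: heavy_join_def)
    qed
  qed
  then obtain a b where ab: "heavy_join a b" "heavy \<subseteq> {a, b}" by blast
  obtain xs where "is_cycle heavy_join xs" "a \<in> set xs" "b \<in> set xs"
    using K.edge_on_cycle[OF ab(1)] .
  then show ?thesis using that ab(2) by blast
qed

text \<open>
  Insertion keeps all vertices of the current cycle, in particular the heavy ones, so it can be
  repeated until the cycle contains \<open>S\<close>.
\<close>
lemma cycle_through:
  assumes "S \<subseteq> V"
    and light: "\<And>v. v \<in> S - heavy \<Longrightarrow>
      card (N2 v - heavy) + 2 \<le> card (N v \<inter> heavy) \<or> card (N2 v) + 1 \<le> card (N v \<inter> heavy)"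
  obtains xs where "is_cycle E xs" "S \<subseteq> set xs"
proof -
  have "\<exists>ys. is_cycle heavy_join ys \<and> S \<subseteq> set ys"
    if "is_cycle heavy_join xs" "heavy \<subseteq> set xs" for xs
    using that
  proof (induction "card (S - set xs)" arbitrary: xs rule: less_induct)
    case less
    show ?case
    proof (cases "S \<subseteq> set xs")
      case True
      then show ?thesis using less.prems by blast
    next
      case False
      then obtain v where v: "v \<in> S" "v \<notin> set xs" by blast
      then have "v \<in> S - heavy" using less.prems(2) by auto
      then obtain ys where ys: "is_cycle heavy_join ys" "set ys = insert v (set xs)"
        using insert_vertex[OF less.prems] v light by metis
      have "card (S - set ys) < card (S - set xs)"
        using v ys(2) finite_subset[OF assms(1) finite_V] by (intro psubset_card_mono) auto
      then show ?thesis using less.hyps ys less.prems(2) by blast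
    qed
  qed
  then obtain ys where "is_cycle heavy_join ys" "S \<subseteq> set ys"
    using cycle_through_heavy by metis
  then show ?thesis using cycle_of_heavy_join_cycle[of ys] that by (metis order_trans)
qed

end

section \<open>Implicit degrees\<close>

lemma card_less_nth_sorted:
  fixes f :: "'a \<Rightarrow> 'b::linorder"
  assumes "finite M" "i < card M"
    and xs: "xs = sorted_list_of_multiset (image_mset f (mset_set M))"
  shows "card {u \<in> M. f u < xs ! i} \<le> i"
proof -
  have mset: "mset xs = image_mset f (mset_set M)" by (simp add: xs)
  have sorted: "sorted xs" by (simp add: xs)
  have len: "length xs = card M" using mset by (metis size_image_mset size_mset size_mset_set)
  have "card {u \<in> M. f u < xs ! i} = size (filter_mset (\<lambda>y. y < xs ! i) (mset xs))"
    using assms(1) by (simp add: mset filter_mset_image_mset filter_mset_mset_set)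
  also have "\<dots> = length (filter (\<lambda>y. y < xs ! i) xs)" by (metis mset_filter size_mset)
  also have "\<dots> = card {j. j < length xs \<and> xs ! j < xs ! i}" by (rule length_filter_conv_card)
  also have "\<dots> \<le> card {..<i}"
    using sorted_nth_mono[OF sorted] assms(2) len
    by (intro card_mono) (auto simp: not_le[symmetric])
  finally show ?thesis by simp
qed

text \<open>
  As the degree of \<open>v\<close> itself is below \<open>c\<close>, the bound \<open>c\<close> is reached by \<open>d\<^sub>k\<close> or by \<open>d\<^sub>k\<^sub>+\<^sub>1\<close>. In the
  first case at most \<open>k - 1\<close> vertices of \<open>N(v) \<union> N\<^sub>2(v)\<close> have degree below \<open>c\<close>. In the second case
  at most \<open>k\<close> vertices have degree below \<open>d\<^sub>k\<^sub>+\<^sub>1\<close>, and all of \<open>N\<^sub>2(v)\<close> are among them because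
  \<open>d\<^sub>k\<^sub>+\<^sub>1 > M\<^sub>2\<close>. The rest is a comparison with the \<open>k + 1\<close> neighbours of \<open>v\<close>. The bound
  \<open>2 \<le> vdegree G v\<close> makes \<open>d\<^sub>k\<close> a genuine entry of the sequence.
\<close>
lemma first_implicit_degree_imp:
  fixes G :: "('a, 'b) pre_digraph"
  assumes fin: "finite (nbrs G v)" "finite (nbrs2 G v)" and disj: "nbrs G v \<inter> nbrs2 G v = {}"
    and deg: "2 \<le> vdegree G v" "vdegree G v < c" and implicit: "c \<le> first_implicit_degree G v"
  defines "H \<equiv> {u. c \<le> vdegree G u}"
  shows "card (nbrs2 G v - H) + 2 \<le> card (nbrs G v \<inter> H) \<or>
    card (nbrs2 G v) + 1 \<le> card (nbrs G v \<inter> H)"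
proof -
  define k where "k = vdegree G v - 1"
  define ds where "ds = sorted_list_of_multiset
    (image_mset (vdegree G) (mset_set (nbrs G v \<union> nbrs2 G v)))"
  have card_N: "card (nbrs G v) = k + 1" using deg(1) by (simp add: k_def vdegree_def)
  have card_Un: "card (nbrs G v \<union> nbrs2 G v) = k + 1 + card (nbrs2 G v)"
    using card_Un_disjoint[OF fin disj] card_N by simp
  \<comment> \<open>List positions start at 0, so \<open>ds ! k\<close> is the term \<open>d\<^sub>k\<^sub>+\<^sub>1\<close>.\<close>
  have below: "card {u \<in> nbrs G v. vdegree G u < ds ! i} + card {u \<in> nbrs2 G v. vdegree G u < ds ! i} \<le> i"
    if "i \<le> k" for i
  proof -
    have "card {u \<in> nbrs G v. vdegree G u < ds ! i} + card {u \<in> nbrs2 G v. vdegree G u < ds ! i}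
        = card ({u \<in> nbrs G v. vdegree G u < ds ! i} \<union> {u \<in> nbrs2 G v. vdegree G u < ds ! i})"
      using fin disj by (intro card_Un_disjoint[symmetric]) auto
    also have "\<dots> = card {u \<in> nbrs G v \<union> nbrs2 G v. vdegree G u < ds ! i}"
      by (rule arg_cong[of _ _ card]) auto
    also have "\<dots> \<le> i"
      using that card_Un fin by (intro card_less_nth_sorted) (auto simp: ds_def)
    finally show ?thesis .
  qed
  have light: "card (X - H) \<le> card {u \<in> X. vdegree G u < ds ! i}" if "c \<le> ds ! i" "finite X" for X i
    using that by (intro card_mono) (auto simp: H_def)
  have split: "card (nbrs G v \<inter> H) + card (nbrs G v - H) = k + 1"
    using card_Int_Diff[OF fin(1), of H] card_N by simp
  have ne: "nbrs2 G v \<noteq> {}" using implicit deg by (auto simp: first_implicit_degree_def)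
  have "(c \<le> ds ! k \<and> Max (vdegree G ` nbrs2 G v) < ds ! k) \<or> c \<le> ds ! (k - 1)"
    using implicit deg ne unfolding first_implicit_degree_def Let_def
    by (auto simp: k_def ds_def split: if_splits)
  then show ?thesis
  proof
    assume *: "c \<le> ds ! k \<and> Max (vdegree G ` nbrs2 G v) < ds ! k"
    then have "{u \<in> nbrs2 G v. vdegree G u < ds ! k} = nbrs2 G v"
      using fin ne by auto
    then show ?thesis using below[of k] light[of k "nbrs G v"] * fin split by simp
  next
    assume "c \<le> ds ! (k - 1)"
    moreover have "1 \<le> k" using deg(1) by (simp add: k_def)
    ultimately show ?thesis
      using below[of "k - 1"] light[of "k - 1" "nbrs G v"] light[of "k - 1" "nbrs2 G v"] fin split
      by linarith
  qed
qed

section \<open>Graphs and their adjacency relations\<close>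

lemma (in graph) sgraph_dominates: "sgraph (verts G) (dominates G)"
proof
  show "finite (verts G)" by simp
  show "x \<in> verts G" if "x \<rightarrow> y" for x y using that by auto
  show "symp (dominates G)" by (auto simp: symp_def intro: arcs_ends_symmetric)
  show "\<not> x \<rightarrow> x" for x using no_loops by (auto simp: arcs_ends_conv)
qed

lemma (in wf_digraph) awalk_of_successively:
  assumes "successively (dominates G) (x # xs)" "x \<in> verts G"
  shows "\<exists>p. awalk x p (last (x # xs)) \<and> awalk_verts x p = x # xs \<and> map (tail G) p = butlast (x # xs)"
  using assms
proof (induction xs arbitrary: x)
  case Nil
  then show ?case by (intro exI[of _ "[]"]) (auto simp: awalk_Nil_iff)
next
  case (Cons y xs)
  then obtain e where e: "e \<in> arcs G" "tail G e = x" "head G e = y"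
    by (auto simp: arcs_ends_conv)
  moreover obtain p where "awalk y p (last (y # xs))" "awalk_verts y p = y # xs"
    "map (tail G) p = butlast (y # xs)"
    using Cons.IH[of y] Cons.prems(1) head_in_verts[of e] e by auto
  ultimately show ?case
    by (intro exI[of _ "e # p"]) (auto simp: awalk_Cons_iff)
qed

text \<open>Repeating the first vertex at the end gives a closed walk whose tails are the list itself.\<close>
lemma (in wf_digraph) cyclable_of_cycle:
  assumes "is_cycle (dominates G) xs" "S \<subseteq> set xs"
  shows "cyclable G S"
proof -
  obtain x ys where xs: "xs = x # ys" using is_cycle_not_Nil[OF assms(1)] by (cases xs) auto
  have cyc: "3 \<le> length xs" "distinct xs" "successively (dominates G) xs" "last xs \<rightarrow> x"
    using assms(1) by (auto simp: is_cycle_def xs)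
  then have "successively (dominates G) (x # (ys @ [x]))" "x \<in> verts G"
    by (auto simp: xs successively_append_iff successively_Cons split: if_splits)
  then obtain p where p: "awalk x p x" "awalk_verts x p = x # ys @ [x]" "map (tail G) p = xs"
    using awalk_of_successively[of x "ys @ [x]"] by (auto simp: xs)
  have "length p = length xs" using p(3) by (metis length_map)
  moreover have "cycle p"
    unfolding cycle_def
    using p cyc(1,2) by (intro exI[of _ x]) (auto simp: xs)
  moreover have "tail G ` set p = set xs" using p(3) by (metis set_map)
  ultimately show ?thesis using cyc(1) assms(2) unfolding cyclable_def
    by (intro exI[of _ p]) auto
qed

lemma (in graph) distance_2_iff:
  assumes "u \<in> verts G" "v \<in> verts G"
  shows "distance G v u = 2 \<longleftrightarrow> u \<noteq> v \<and> \<not> v \<rightarrow> u \<and> (\<exists>z. v \<rightarrow> z \<and> z \<rightarrow> u)"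
proof -
  have cost: "awalk_cost (\<lambda>_. 1) p = real (length p)" for p :: "'b list"
    by (induction p) auto
  have le: "distance G v u \<le> ereal (real (length p))" if "awalk v p u" for p
    using min_cost_le_walk_cost[OF that, of "\<lambda>_. 1"] by (simp add: cost distance_def)
  have ex: "\<exists>p. awalk v p u \<and> distance G v u = ereal (real (length p))" if "v \<rightarrow>\<^sup>* u"
    using min_cost_awalk[OF that, of "\<lambda>_. 1"] by (auto simp: cost distance_def apath_def)
  have walk2: "\<exists>p. awalk v p u \<and> length p = 2" if zz: "v \<rightarrow> z" "z \<rightarrow> u" for z
  proof -
    obtain e f where "e \<in> arcs G" "tail G e = v" "head G e = z"
      "f \<in> arcs G" "tail G f = z" "head G f = u"
      using zz by (auto simp: arcs_ends_conv)
    then show ?thesis using assms by (intro exI[of _ "[e, f]"]) (auto simp: awalk_simps)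
  qed
  show ?thesis
  proof
    assume d: "distance G v u = 2"
    then have "wf_digraph.\<mu> G (\<lambda>_. 1) v u < \<infinity>" by (simp add: distance_def)
    then have "v \<rightarrow>\<^sup>* u" by (simp only: \<mu>_reach_conv)
    then obtain p where p: "awalk v p u" "length p = 2"
      using ex d by fastforce
    then obtain e f where "p = [e, f]" by (auto simp: length_Suc_conv numeral_2_eq_2)
    then have "e \<in> arcs G" "tail G e = v" "f \<in> arcs G" "tail G f = head G e" "head G f = u"
      using p(1) by (auto simp: awalk_simps)
    then have "\<exists>z. v \<rightarrow> z \<and> z \<rightarrow> u" by (metis in_arcs_imp_in_arcs_ends)
    moreover have "u \<noteq> v" using le[of "[]"] assms d by (auto simp: awalk_Nil_iff)
    moreover have "\<not> v \<rightarrow> u"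
    proof
      assume "v \<rightarrow> u"
      then obtain e where "e \<in> arcs G" "tail G e = v" "head G e = u"
        by (auto simp: arcs_ends_conv)
      then show False using le[of "[e]"] assms d by (auto simp: awalk_simps)
    qed
    ultimately show "u \<noteq> v \<and> \<not> v \<rightarrow> u \<and> (\<exists>z. v \<rightarrow> z \<and> z \<rightarrow> u)" by blast
  next
    assume R: "u \<noteq> v \<and> \<not> v \<rightarrow> u \<and> (\<exists>z. v \<rightarrow> z \<and> z \<rightarrow> u)"
    then obtain p where p: "awalk v p u" "length p = 2" using walk2 by blast
    then have "v \<rightarrow>\<^sup>* u" by (auto simp: reachable_awalk)
    then obtain q where q: "awalk v q u" "distance G v u = ereal (real (length q))"
      using ex by blast
    have "length q \<le> 2" using le[OF p(1)] p(2) q(2) by simp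
    moreover have "length q \<noteq> 0" using q(1) R by (auto simp: awalk_Nil_iff)
    moreover have "length q \<noteq> 1"
    proof
      assume "length q = 1"
      then obtain e where "q = [e]" by (auto simp: length_Suc_conv)
      then show False using q(1) R by (auto simp: awalk_simps intro: in_arcs_imp_in_arcs_ends)
    qed
    ultimately have "length q = 2" by linarith
    then show "distance G v u = 2" using q(2) by simp
  qed
qed

lemma (in graph) biconnected_dominates:
  assumes "k_connected 2 G"
  shows "biconnected_sgraph (verts G) (dominates G)"
proof -
  interpret S: sgraph "verts G" "dominates G" by (rule sgraph_dominates)
  show ?thesis
  proof
    show "3 \<le> card (verts G)" using assms by (simp add: k_connected_def)
  next
    fix w x y assume w: "w \<in> verts G" and xy: "x \<in> verts G - {w}" "y \<in> verts G - {w}"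
    let ?H = "G \<restriction> (verts G - {w})"
    interpret H: wf_digraph ?H by (rule wellformed_induce_subgraph)
    have "induced_subgraph ?H G" by (rule induced_induce) auto
    then have symH: "symmetric ?H" using induced_graph_imp_symmetric[OF sym_arcs] by blast
    have "Digraph_Component.connected ?H" using assms w by (auto simp: k_connected_def)
    then have "x \<rightarrow>\<^sup>*\<^bsub>mk_symmetric ?H\<^esub> y"
      using xy by (auto simp: connected_def strongly_connected_def)
    then have "x \<rightarrow>\<^sup>*\<^bsub>?H\<^esub> y" using H.reachable_mk_symmetric_eq[OF symH] by simp
    then have "(x, y) \<in> (arcs_ends ?H)\<^sup>*"
      unfolding reachable_def by (rule rtrancl_on_rtranclI)
    then show "(\<lambda>a b. a \<rightarrow> b \<and> a \<noteq> w \<and> b \<noteq> w)\<^sup>*\<^sup>* x y"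
    proof induction
      case (step b c)
      then have "b \<rightarrow> c \<and> b \<noteq> w \<and> c \<noteq> w" by (auto simp: arcs_ends_conv)
      with step.IH show ?case by (rule rtranclp.rtrancl_into_rtrancl)
    qed simp
  qed
qed

theorem fact2:
  fixes G :: "('a, 'b) pre_digraph" and n :: nat and S :: "'a set"
  assumes "graph G"
    and "k_connected 2 G"
    and "card (verts G) = n" and "n \<ge> 3"
    and "S = {v \<in> verts G. real (first_implicit_degree G v) \<ge> real n / 2}"
  shows "cyclable G S"
proof -
  interpret graph G by fact
  interpret B: biconnected_sgraph "verts G" "dominates G"
    using assms(2) by (rule biconnected_dominates)
  have N: "B.N v = nbrs G v" for v by (simp add: B.N_def nbrs_def)
  have N2: "B.N2 v = nbrs2 G v" if "v \<in> verts G" for v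
    using distance_2_iff[OF _ that] B.N2_subset[of v] by (auto simp: B.N2_def nbrs2_def)
  \<comment> \<open>For natural numbers, being at least \<open>n/2\<close> means being at least \<open>n/2\<close> rounded up.\<close>
  define c where "c = (n + 1) div 2"
  have heavy: "B.heavy = {u \<in> verts G. c \<le> vdegree G u}"
    using assms(3) by (auto simp: B.heavy_def N vdegree_def c_def)
  have S: "S = {v \<in> verts G. c \<le> first_implicit_degree G v}"
    unfolding assms(5) c_def by auto
  obtain xs where "is_cycle (dominates G) xs" "S \<subseteq> set xs"
  proof (rule B.cycle_through)
    show "S \<subseteq> verts G" by (auto simp: S)
  next
    fix v assume v: "v \<in> S - B.heavy"
    let ?H = "{u. c \<le> vdegree G u}"
    have vV: "v \<in> verts G" using v by (simp add: S)
    have "card (nbrs2 G v - ?H) + 2 \<le> card (nbrs G v \<inter> ?H) \<or>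
        card (nbrs2 G v) + 1 \<le> card (nbrs G v \<inter> ?H)"
    proof (rule first_implicit_degree_imp)
      show "finite (nbrs G v)" "finite (nbrs2 G v)"
        using B.finite_N[of v] B.finite_N2[of v] N N2[OF vV] by auto
      show "nbrs G v \<inter> nbrs2 G v = {}" by (auto simp flip: N N2[OF vV] simp: B.N_def B.N2_def)
      show "2 \<le> vdegree G v" using B.degree_ge_2[OF vV] by (simp add: N vdegree_def)
      show "vdegree G v < c" "c \<le> first_implicit_degree G v"
        using v by (auto simp: S heavy)
    qed
    moreover have "nbrs G v \<inter> ?H = B.N v \<inter> B.heavy" "nbrs2 G v - ?H = B.N2 v - B.heavy"
      using B.N_subset[of v] B.N2_subset[of v] by (auto simp: N N2[OF vV] heavy)
    ultimately show "card (B.N2 v - B.heavy) + 2 \<le> card (B.N v \<inter> B.heavy) \<or>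
        card (B.N2 v) + 1 \<le> card (B.N v \<inter> B.heavy)"
      by (simp add: N2[OF vV])
  qed
  then show ?thesis by (rule cyclable_of_cycle)
qed

end
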